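(* Let $n \ge 2$ and let $H = (h_{ij})$, indexed by unordered pairs $\{i,j\}$ of distinct elements of $[n]$ (so $h_{ij}=h_{ji}$), where each $h_{ij}$ is either an element of $\mathbf{R}\cup\{+\infty\}$ ("defined") or "undefined". Assume that $h_{ij} \ge 0$ for every defined $h_{ij}$, and that $h_{ij} \ge \min\{h_{jk}, h_{ik}\}$ whenever $i,j,k$ are distinct and $h_{ij}, h_{jk}, h_{ik}$ are all defined. Let $G_H = ([n], E_H; w)$ be the edge-weighted graph with $E_H = \{\{i,j\} : i \ne j,\ h_{ij} \text{ defined}\}$ and $w(\{i,j\}) = h_{ij}$. Then $H$ is M${}^\natural$-convex completable if and only if for every chordless cycle $C$ of $G_H$, the minimum of $w$ over the edges of $C$ is attained by at least two distinct edges of $C$.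
   Context: Conventions: $a<+\infty$, $a+(+\infty)=+\infty$ for $a\in\mathbf{R}$, $0\cdot(+\infty)=0$. A function $f : \{0,1\}^n \to \mathbf{R}\cup\{+\infty\}$ is M${}^\natural$-convex if for all $x,y \in \{0,1\}^n$ and all $i$ with $x_i > y_i$ there exists $j \in \{j : y_j > x_j\} \cup \{0\}$ such that $f(x)+f(y) \ge f(x-\chi_i+\chi_j)+f(y+\chi_i-\chi_j)$, where $\chi_i$ is the $i$-th unit vector and $\chi_0 = 0$. $H$ is called M${}^\natural$-convex completable if one can assign values in $\mathbf{R}\cup\{+\infty\}$ to all undefined entries (keeping symmetry) so that, for the resulting fully defined $(h_{ij})$ and some real numbers $h_1,\dots,h_n$, the function $f(x) = \sum_{i} h_i x_i + \sum_{i<j} h_{ij} x_i x_j$ on $\{0,1\}^n$ is M${}^\natural$-convex. A chordless cycle of a graph is a cycle (of length at least 3) such that no edge of the graph joins two non-consecutive vertices of the cycle. *)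

theory Defs
  imports "HOL-Library.Extended_Real" "HOL-Library.Function_Algebras"
begin

(* R with +infinity adjoined is the type ereal without -infinity. On it, ereal arithmetic
   agrees with the usual conventions a + (+infinity) = +infinity and 0 * (+infinity) = 0.
   Vectors of R^n are functions on nat that vanish outside {1..n}. *)

definition cube :: "nat \<Rightarrow> (nat \<Rightarrow> real) set" where
  "cube n = {x. (\<forall>i\<in>{1..n}. x i \<in> {0, 1}) \<and> (\<forall>i. i \<notin> {1..n} \<longrightarrow> x i = 0)}"

(* Coordinates start at 1, so that index 0 is free to denote the zero vector. *)
definition unit_vec :: "nat \<Rightarrow> nat \<Rightarrow> real" where
  "unit_vec i = (\<lambda>k. if i \<noteq> 0 \<and> k = i then 1 else 0)"

definition M_natural_convex :: "nat \<Rightarrow> ((nat \<Rightarrow> real) \<Rightarrow> ereal) \<Rightarrow> bool" where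
  "M_natural_convex n f \<longleftrightarrow>
     (\<forall>x\<in>cube n. f x \<noteq> -\<infinity>) \<and>
     (\<forall>x\<in>cube n. \<forall>y\<in>cube n. \<forall>i\<in>{1..n}. x i > y i \<longrightarrow>
        (\<exists>j\<in>{j\<in>{1..n}. y j > x j} \<union> {0}.
           f x + f y \<ge> f (x - unit_vec i + unit_vec j) + f (y + unit_vec i - unit_vec j)))"

definition pairs :: "nat \<Rightarrow> nat set set" where
  "pairs n = {{i, j} | i j. i \<in> {1..n} \<and> j \<in> {1..n} \<and> i \<noteq> j}"

(* A partially defined symmetric matrix is a partial map on unordered pairs: the entry h_ij
   is H {i, j}, and it is undefined if H {i, j} = None. *)
definition partial_matrix :: "nat \<Rightarrow> (nat set \<rightharpoonup> ereal) \<Rightarrow> bool" where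
  "partial_matrix n H \<longleftrightarrow> dom H \<subseteq> pairs n \<and> -\<infinity> \<notin> ran H"

definition quadratic :: "nat \<Rightarrow> (nat \<Rightarrow> real) \<Rightarrow> (nat set \<Rightarrow> ereal) \<Rightarrow> (nat \<Rightarrow> real) \<Rightarrow> ereal" where
  "quadratic n l q x =
     (\<Sum>i\<in>{1..n}. ereal (l i) * ereal (x i)) +
     (\<Sum>i\<in>{1..n}. \<Sum>j\<in>{i<..n}. q {i, j} * ereal (x i) * ereal (x j))"

definition M_natural_convex_completable :: "nat \<Rightarrow> (nat set \<rightharpoonup> ereal) \<Rightarrow> bool" where
  "M_natural_convex_completable n H \<longleftrightarrow>
     (\<exists>(q :: nat set \<Rightarrow> ereal) (l :: nat \<Rightarrow> real).
        (\<forall>e\<in>pairs n. q e \<noteq> -\<infinity>) \<and>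
        (\<forall>e\<in>pairs n. \<forall>a. H e = Some a \<longrightarrow> q e = a) \<and>
        M_natural_convex n (quadratic n l q))"

definition graph_edges :: "nat \<Rightarrow> (nat set \<rightharpoonup> ereal) \<Rightarrow> nat set set" where
  "graph_edges n H = {e \<in> pairs n. H e \<noteq> None}"

definition weight :: "(nat set \<rightharpoonup> ereal) \<Rightarrow> nat set \<Rightarrow> ereal" where
  "weight H e = the (H e)"

(* A cycle is given by the list of its vertices in cyclic order. *)
definition cycle_edges :: "'a list \<Rightarrow> 'a set set" where
  "cycle_edges c = {{c ! k, c ! (Suc k mod length c)} | k. k < length c}"

definition is_cycle :: "'a set \<Rightarrow> 'a set set \<Rightarrow> 'a list \<Rightarrow> bool" where
  "is_cycle V E c \<longleftrightarrow>
     length c \<ge> 3 \<and> distinct c \<and> set c \<subseteq> V \<and> cycle_edges c \<subseteq> E"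

definition chordless_cycle :: "'a set \<Rightarrow> 'a set set \<Rightarrow> 'a list \<Rightarrow> bool" where
  "chordless_cycle V E c \<longleftrightarrow>
     is_cycle V E c \<and>
     (\<forall>k<length c. \<forall>m<length c.
        k \<noteq> m \<and> m \<noteq> Suc k mod length c \<and> k \<noteq> Suc m mod length c \<longrightarrow> {c ! k, c ! m} \<notin> E)"

definition min_attained_twice :: "('a set \<Rightarrow> ereal) \<Rightarrow> 'a list \<Rightarrow> bool" where
  "min_attained_twice w c \<longleftrightarrow>
     (\<exists>e\<in>cycle_edges c. \<exists>e'\<in>cycle_edges c. e \<noteq> e' \<and>
        w e = Min (w ` cycle_edges c) \<and> w e' = Min (w ` cycle_edges c))"

end

theory Submission imports Defs "HOL-Library.Indicator_Function" begin

text \<open>A quadratic set function with finite linear part is M-natural-convex iff its off-diagonal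
  coefficients are nonnegative and \<open>q {i, j} \<ge> min (q {i, k}) (q {k, j})\<close>, i.e. iff
  \<open>t \<le> q {i, j}\<close> is a transitive relation for every threshold \<open>t\<close>. On a cycle of such coefficients
  no edge can be the only minimal one. Conversely, complete \<open>H\<close> by the bottleneck value
  of the best path from \<open>i\<close> to \<open>j\<close> (\<open>0\<close> if there is none); the condition on chordless cycles
  says precisely that this leaves the defined entries unchanged.\<close>

section \<open>Comparing sums through superlevel sets\<close>

text \<open>Greedy matching: the largest value of \<open>g\<close> is dominated by some value of
  \<open>f\<close>, and deleting both keeps the counting hypothesis. Left-over members of
  \<open>P\<close> only help, since \<open>f\<close> is nonnegative. Values are never subtracted, so
  infinite ones are harmless.\<close>

lemma sum_le_sum_if_card_superlevel_le:
  fixes f :: "'a \<Rightarrow> ereal" and g :: "'b \<Rightarrow> ereal"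
  assumes "finite P" "finite Q" "\<And>p. p \<in> P \<Longrightarrow> 0 \<le> f p"
    and "\<And>t. 0 < t \<Longrightarrow> card {q \<in> Q. t \<le> g q} \<le> card {p \<in> P. t \<le> f p}"
  shows "sum g Q \<le> sum f P"
  using assms(2,1,3,4)
proof (induction "card Q" arbitrary: P Q)
  case 0
  then show ?case by (simp add: sum_nonneg)
next
  case (Suc m)
  then have "Q \<noteq> {}" by auto
  then have "Max (g ` Q) \<in> g ` Q" using Suc.prems(1) by (intro Max_in) auto
  then obtain q where "q \<in> Q" "g q = Max (g ` Q)" by (metis imageE)
  then have q: "q \<in> Q" "\<And>q'. q' \<in> Q \<Longrightarrow> g q' \<le> g q" using Suc.prems(1) by auto
  show ?case
  proof (cases "g q \<le> 0")
    case True
    then have "sum g Q \<le> 0" using q(2) by (intro sum_nonpos) (metis order_trans)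
    then show ?thesis using Suc.prems(3) by (metis sum_nonneg order_trans)
  next
    case False
    have "0 < card {q' \<in> Q. g q \<le> g q'}"
      using q(1) Suc.prems(1) by (auto simp: card_gt_0_iff)
    also have "\<dots> \<le> card {p \<in> P. g q \<le> f p}" using False by (intro Suc.prems(4)) simp
    finally obtain p where p: "p \<in> P" "g q \<le> f p" by (auto simp: card_gt_0_iff)
    have "sum g (Q - {q}) \<le> sum f (P - {p})"
    proof (rule Suc.hyps(1))
      show "m = card (Q - {q})" using Suc.hyps(2) q(1) by simp
    next
      fix t :: ereal assume t: "0 < t"
      show "card {q' \<in> Q - {q}. t \<le> g q'} \<le> card {p' \<in> P - {p}. t \<le> f p'}"
      \<comment> \<open>Up to level \<open>g q\<close> both superlevel sets lose exactly one
        element; above it the one of \<open>g\<close> is empty by the choice of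
        \<open>q\<close>.\<close>
      proof (cases "t \<le> g q")
        case True
        have "{q' \<in> Q - {q}. t \<le> g q'} = {q' \<in> Q. t \<le> g q'} - {q}"
             "{p' \<in> P - {p}. t \<le> f p'} = {p' \<in> P. t \<le> f p'} - {p}" by auto
        moreover have "q \<in> {q' \<in> Q. t \<le> g q'}" "p \<in> {p' \<in> P. t \<le> f p'}"
          using True q p by auto
        ultimately show ?thesis using Suc.prems(4)[OF t] by (simp add: diff_le_mono)
      next
        case False
        then have "{q' \<in> Q - {q}. t \<le> g q'} = {}" using q(2) by (auto dest: order_trans)
        then show ?thesis by (metis card.empty zero_le)
      qed
    qed (use Suc.prems in auto)
    then have "g q + sum g (Q - {q}) \<le> f p + sum f (P - {p})" using p(2) by (rule add_mono[rotated])
    then show ?thesis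
      using sum.remove[OF Suc.prems(1) q(1), of g] sum.remove[OF Suc.prems(2) p(1), of f] by simp
  qed
qed

text \<open>Maximal members of a laminar family are disjoint and cover its union, so their
  inequalities add up. The induction splits off one maximal \<open>W\<close> together with all
  members inside it.\<close>

lemma laminar_card_Int_Union_le:
  assumes "finite \<F>" "finite A" "finite B"
    and "\<And>V W. V \<in> \<F> \<Longrightarrow> W \<in> \<F> \<Longrightarrow> V \<subseteq> W \<or> W \<subseteq> V \<or> V \<inter> W = {}"
    and "\<And>W. W \<in> \<F> \<Longrightarrow> card (B \<inter> W) \<le> card (A \<inter> W)"
  shows "card (B \<inter> \<Union>\<F>) \<le> card (A \<inter> \<Union>\<F>)"
  using assms(1,4,5)
proof (induction \<F> rule: finite_psubset_induct)
  case (psubset \<F>)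
  show ?case
  proof (cases "\<F> = {}")
    case False
    then obtain W where W: "W \<in> \<F>" "\<And>V. V \<in> \<F> \<Longrightarrow> W \<subseteq> V \<Longrightarrow> W = V"
      using finite_has_maximal[OF psubset.hyps(1)] by blast
    define \<G> where "\<G> = {V \<in> \<F>. \<not> V \<subseteq> W}"
    have disj: "V \<inter> W = {}" if "V \<in> \<G>" for V
      using that W psubset.prems(1)[of V W] unfolding \<G>_def by blast
    have U: "\<Union>\<F> = W \<union> \<Union>\<G>" using W(1) unfolding \<G>_def by blast
    have split: "card (C \<inter> \<Union>\<F>) = card (C \<inter> W) + card (C \<inter> \<Union>\<G>)" if "finite C" for C
    proof -
      have "C \<inter> \<Union>\<F> = (C \<inter> W) \<union> (C \<inter> \<Union>\<G>)" using U by blast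
      moreover have "(C \<inter> W) \<inter> (C \<inter> \<Union>\<G>) = {}" using disj by blast
      ultimately show ?thesis using that by (simp add: card_Un_disjoint)
    qed
    have "\<G> \<subset> \<F>" using W(1) unfolding \<G>_def by blast
    moreover have "card (B \<inter> \<Union>\<G>) \<le> card (A \<inter> \<Union>\<G>)"
      using \<open>\<G> \<subset> \<F>\<close> psubset.prems by (intro psubset.IH) blast+
    ultimately show ?thesis
      using split[OF assms(2)] split[OF assms(3)] psubset.prems(2)[OF W(1)] by simp
  qed simp
qed

section \<open>Exchange for ultrametric similarities\<close>

text \<open>An ultrametric with the order reversed: large values mean closeness. The diagonal value
  puts every point into its own cluster at every level, \<open>\<infinity>\<close> included.\<close>

locale ultrametric_similarity =
  fixes d :: "'v \<Rightarrow> 'v \<Rightarrow> ereal"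
  assumes self [simp]: "d x x = \<infinity>"
    and sym: "d x y = d y x"
    and nonneg: "0 \<le> d x y"
    and ultra: "min (d x y) (d y z) \<le> d x z"
begin

text \<open>A closed ball; at a fixed level the clusters are the classes of the equivalence relation
  \<open>t \<le> d x y\<close>.\<close>

definition cluster :: "ereal \<Rightarrow> 'v \<Rightarrow> 'v set" where
  "cluster t x = {y. t \<le> d x y}"

lemma trans_le: "t \<le> d x y \<Longrightarrow> t \<le> d y z \<Longrightarrow> t \<le> d x z"
  using ultra[of x y z] by (simp add: min_def split: if_splits)

lemma self_in_cluster [simp]: "x \<in> cluster t x"
  by (simp add: cluster_def)

lemma in_cluster_sym: "y \<in> cluster t x \<longleftrightarrow> x \<in> cluster t y"
  by (simp add: cluster_def sym)

lemma cluster_eq: "y \<in> cluster t x \<Longrightarrow> cluster t y = cluster t x"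
  using trans_le[of t x y] trans_le[of t y x] sym[of x y] unfolding cluster_def by auto

lemma cluster_antimono: "s \<le> t \<Longrightarrow> cluster t x \<subseteq> cluster s x"
  unfolding cluster_def by auto

text \<open>Two clusters with a common point \<open>z\<close> can be recentred at \<open>z\<close>;
  then their levels decide which contains the other.\<close>

lemma cluster_laminar:
  "cluster s x \<subseteq> cluster t y \<or> cluster t y \<subseteq> cluster s x \<or> cluster s x \<inter> cluster t y = {}"
proof (cases "cluster s x \<inter> cluster t y = {}")
  case False
  then obtain z where "z \<in> cluster s x" "z \<in> cluster t y" by blast
  then have "cluster s x = cluster s z" "cluster t y = cluster t z" using cluster_eq by blast+
  then show ?thesis using cluster_antimono by (metis linear)
qed simp

text \<open>The chosen \<open>j\<close> leaves \<open>i\<close> at a scale below which every cluster of \<open>i\<close> is short of elements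
  of \<open>B\<close> and every cluster of \<open>j\<close> has a surplus of them. If no such \<open>j\<close> existed, then the offending
  clusters would cover \<open>B \<inter> cluster t i\<close> for a critical \<open>t\<close>, and be a laminar family without surplus.\<close>

lemma balanced_partner:
  assumes fin: "finite A" "finite B" and i: "i \<notin> A" "i \<notin> B"
    and surplus: "0 < s" "card (A \<inter> cluster s i) < card (B \<inter> cluster s i)"
  obtains j where "j \<in> B"
    "\<And>t. j \<notin> cluster t i \<Longrightarrow> card (B \<inter> cluster t i) \<le> card (A \<inter> cluster t i)"
    "\<And>t. j \<notin> cluster t i \<Longrightarrow> card (A \<inter> cluster t j) < card (B \<inter> cluster t j)"
proof -
  define S where "S = insert i (A \<union> B)"
  have finS: "finite S" and AB: "A \<subseteq> S" "B \<subseteq> S" using fin by (auto simp: S_def)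
  define crit where "crit t \<longleftrightarrow> card (A \<inter> cluster t i) < card (B \<inter> cluster t i)" for t
  \<comment> \<open>\<open>u\<close> is a critical level with the smallest trace on
    \<open>S\<close>. A level separating \<open>i\<close> from a point of \<open>B\<close> in
    \<open>cluster u i\<close> has a strictly smaller trace and hence is not critical.\<close>
  obtain u where u: "crit u" "\<And>t. crit t \<Longrightarrow> card (S \<inter> cluster u i) \<le> card (S \<inter> cluster t i)"
    using ex_has_least_nat[of crit s "\<lambda>t. card (S \<inter> cluster t i)"] surplus crit_def by blast
  \<comment> \<open>These are the clusters that disqualify a candidate \<open>j\<close>: they
    separate it from \<open>i\<close> without a surplus of \<open>B\<close>.\<close>
  define \<F> where "\<F> = {S \<inter> cluster t j | t j. j \<in> B \<inter> cluster u i \<and> j \<notin> cluster t i \<and>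
    card (B \<inter> cluster t j) \<le> card (A \<inter> cluster t j)}"
  have finF: "finite \<F>" using finS by (rule finite_subset[rotated, OF finite_Pow_iff[THEN iffD2]]) (auto simp: \<F>_def)
  have inside: "W \<subseteq> cluster u i - {i}" if WF: "W \<in> \<F>" for W
  proof -
    obtain t j where W: "W = S \<inter> cluster t j" and j: "j \<in> cluster u i" "j \<notin> cluster t i"
      using WF unfolding \<F>_def by blast
    have "u \<le> t" using j cluster_antimono by (metis linear subsetD)
    then have "cluster t j \<subseteq> cluster u j" by (rule cluster_antimono)
    moreover have "cluster u j = cluster u i" using j(1) by (rule cluster_eq)
    ultimately show ?thesis using W j in_cluster_sym by blast
  qed
  have "card (B \<inter> \<Union>\<F>) \<le> card (A \<inter> \<Union>\<F>)"
  proof (rule laminar_card_Int_Union_le[OF finF fin])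
    fix V W assume "V \<in> \<F>" "W \<in> \<F>"
    then obtain s x t y where "V = S \<inter> cluster s x" "W = S \<inter> cluster t y" unfolding \<F>_def by blast
    then show "V \<subseteq> W \<or> W \<subseteq> V \<or> V \<inter> W = {}" using cluster_laminar[of s x t y] by blast
  next
    fix W assume "W \<in> \<F>"
    then obtain t j where "W = S \<inter> cluster t j" "card (B \<inter> cluster t j) \<le> card (A \<inter> cluster t j)"
      unfolding \<F>_def by blast
    moreover have "B \<inter> (S \<inter> cluster t j) = B \<inter> cluster t j" "A \<inter> (S \<inter> cluster t j) = A \<inter> cluster t j"
      using AB by blast+
    ultimately show "card (B \<inter> W) \<le> card (A \<inter> W)" by simp
  qed
  also have "\<dots> \<le> card (A \<inter> cluster u i)"
    using inside fin(1) by (intro card_mono) auto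
  also have "\<dots> < card (B \<inter> cluster u i)" using u(1) by (simp add: crit_def)
  \<comment> \<open>By counting, \<open>\<Union>\<F>\<close> misses a point of \<open>B\<close> in
    \<open>cluster u i\<close>; that point is the partner.\<close>
  finally have "\<not> B \<inter> cluster u i \<subseteq> B \<inter> \<Union>\<F>"
    using fin(2) by (meson card_mono finite_Int leD)
  then obtain j where j: "j \<in> B" "j \<in> cluster u i" "j \<notin> \<Union>\<F>" by blast
  show thesis
  proof (rule that[of j])
    show "j \<in> B" by fact
    fix t assume t: "j \<notin> cluster t i"
    show "card (B \<inter> cluster t i) \<le> card (A \<inter> cluster t i)"
    proof (rule ccontr)
      assume "\<not> ?thesis"
      then have "card (S \<inter> cluster u i) \<le> card (S \<inter> cluster t i)" by (intro u(2)) (simp add: crit_def)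
      moreover have "S \<inter> cluster t i \<subset> S \<inter> cluster u i"
      proof -
        have "u \<le> t" using j(2) t cluster_antimono by (metis linear subsetD)
        then show ?thesis using cluster_antimono[of u t i] j t AB by blast
      qed
      ultimately show False using finS by (meson finite_Int leD psubset_card_mono)
    qed
    show "card (A \<inter> cluster t j) < card (B \<inter> cluster t j)"
    proof (rule ccontr)
      assume "\<not> ?thesis"
      then have "card (B \<inter> cluster t j) \<le> card (A \<inter> cluster t j)" by simp
      then have "S \<inter> cluster t j \<in> \<F>" using j t unfolding \<F>_def by blast
      then show False using j AB by auto
    qed
  qed
qed

text \<open>The exchange axiom with the common part of the two sets removed. If no cluster of
  \<open>i\<close> at a positive level has more of \<open>B\<close> than of \<open>A\<close>,
  comparing superlevel sets gives the first alternative; otherwise \<open>balanced_partner\<close>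
  supplies \<open>j\<close>.\<close>

lemma exchange:
  assumes fin: "finite A" "finite B" and i: "i \<notin> A" "i \<notin> B" and AB: "A \<inter> B = {}"
  shows "sum (d i) B \<le> sum (d i) A \<or>
    (\<exists>j\<in>B. sum (d j) A + sum (d i) (B - {j}) \<le> sum (d i) A + sum (d j) (B - {j}))"
proof (cases "\<forall>t>0. card (B \<inter> cluster t i) \<le> card (A \<inter> cluster t i)")
  case True
  have "{x \<in> C. t \<le> d i x} = C \<inter> cluster t i" for C t by (auto simp: cluster_def)
  then have "sum (d i) B \<le> sum (d i) A"
    using True fin nonneg by (intro sum_le_sum_if_card_superlevel_le) auto
  then show ?thesis ..
next
  case False
  then obtain s where "0 < s" "card (A \<inter> cluster s i) < card (B \<inter> cluster s i)"
    by (auto simp: not_le)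
  then obtain j where j: "j \<in> B"
    "\<And>t. j \<notin> cluster t i \<Longrightarrow> card (B \<inter> cluster t i) \<le> card (A \<inter> cluster t i)"
    "\<And>t. j \<notin> cluster t i \<Longrightarrow> card (A \<inter> cluster t j) < card (B \<inter> cluster t j)"
    using balanced_partner[OF fin i] by blast
  define D where "D = B - {j}"
  have D: "finite D" "A \<inter> D = {}" using fin AB by (auto simp: D_def)
  \<comment> \<open>Each side becomes one sum over the disjoint union \<open>A \<union> D\<close>;
    \<open>f\<close> and \<open>g\<close> differ by swapping \<open>i\<close> and
    \<open>j\<close>.\<close>
  define f where "f p = (if p \<in> A then d i p else d j p)" for p
  define g where "g p = (if p \<in> A then d j p else d i p)" for p
  have "sum g (A \<union> D) \<le> sum f (A \<union> D)"
  proof (rule sum_le_sum_if_card_superlevel_le)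
    fix t :: ereal
    have f: "{p \<in> A \<union> D. t \<le> f p} = (A \<inter> cluster t i) \<union> (D \<inter> cluster t j)"
      and g: "{p \<in> A \<union> D. t \<le> g p} = (A \<inter> cluster t j) \<union> (D \<inter> cluster t i)"
      using D(2) by (auto simp: f_def g_def cluster_def)
    show "card {p \<in> A \<union> D. t \<le> g p} \<le> card {p \<in> A \<union> D. t \<le> f p}"
    proof (cases "j \<in> cluster t i")
      \<comment> \<open>A level that does not separate \<open>i\<close> from \<open>j\<close> gives
        both the same cluster, so the two counts agree.\<close>
      case True
      then show ?thesis unfolding f g using cluster_eq by simp
    next
      case False
      have "D \<inter> cluster t i = B \<inter> cluster t i" using False by (auto simp: D_def)
      then have "card (D \<inter> cluster t i) \<le> card (A \<inter> cluster t i)" using j(2)[OF False] by simp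
      \<comment> \<open>The surplus at \<open>j\<close> is strict, which pays for the removal of
        \<open>j\<close> from \<open>B\<close>.\<close>
      moreover have "card (A \<inter> cluster t j) \<le> card (D \<inter> cluster t j)"
      proof -
        have "D \<inter> cluster t j = B \<inter> cluster t j - {j}" by (auto simp: D_def)
        then have "card (D \<inter> cluster t j) = card (B \<inter> cluster t j) - 1" using j(1) by simp
        then show ?thesis using j(3)[OF False] by simp
      qed
      moreover have "card ((A \<inter> cluster s x) \<union> (D \<inter> cluster t y)) =
          card (A \<inter> cluster s x) + card (D \<inter> cluster t y)" for s x t y
        using D fin by (intro card_Un_disjoint) auto
      ultimately show ?thesis unfolding f g by simp
    qed
  qed (use D fin nonneg in \<open>auto simp: f_def\<close>)
  moreover have "sum f (A \<union> D) = sum (d i) A + sum (d j) D"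
  proof -
    have "sum f (A \<union> D) = sum f A + sum f D" using fin D by (simp add: sum.union_disjoint)
    also have "sum f A = sum (d i) A" by (simp add: f_def)
    also have "sum f D = sum (d j) D" using D(2) by (intro sum.cong) (auto simp: f_def)
    finally show ?thesis .
  qed
  moreover have "sum g (A \<union> D) = sum (d j) A + sum (d i) D"
  proof -
    have "sum g (A \<union> D) = sum g A + sum g D" using fin D by (simp add: sum.union_disjoint)
    also have "sum g A = sum (d j) A" by (simp add: g_def)
    also have "sum g D = sum (d i) D" using D(2) by (intro sum.cong) (auto simp: g_def)
    finally show ?thesis .
  qed
  ultimately show ?thesis using j(1) unfolding D_def by auto
qed

end

section \<open>Quadratic functions on subsets\<close>

definition pair_sum :: "(nat set \<Rightarrow> ereal) \<Rightarrow> nat set \<Rightarrow> ereal" where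
  "pair_sum q X = (\<Sum>(i, j)\<in>{(i, j) \<in> X \<times> X. i < j}. q {i, j})"

lemma pair_sum_empty [simp]: "pair_sum q {} = 0"
  by (simp add: pair_sum_def)

lemma pair_sum_insert:
  assumes "finite X" "k \<notin> X"
  shows "pair_sum q (insert k X) = pair_sum q X + (\<Sum>x\<in>X. q {k, x})"
proof -
  define P where "P = {(i, j) \<in> X \<times> X. i < j}"
  define e where "e x = (if x < k then (x, k) else (k, x))" for x
  have inj: "inj_on e X" using assms(2) by (auto simp: inj_on_def e_def split: if_splits)
  have eq: "{(i, j) \<in> insert k X \<times> insert k X. i < j} = P \<union> e ` X"
    using assms(2) by (auto simp: P_def e_def image_iff not_less less_le)
  have "finite P" by (rule finite_subset[of _ "X \<times> X"]) (use assms in \<open>auto simp: P_def\<close>)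
  moreover have "P \<inter> e ` X = {}" using assms(2) by (auto simp: P_def e_def split: if_splits)
  ultimately have "pair_sum q (insert k X) =
      (\<Sum>(i, j)\<in>P. q {i, j}) + (\<Sum>(i, j)\<in>e ` X. q {i, j})"
    unfolding pair_sum_def eq using assms(1) by (intro sum.union_disjoint) auto
  also have "(\<Sum>(i, j)\<in>e ` X. q {i, j}) = (\<Sum>x\<in>X. q {k, x})"
    unfolding sum.reindex[OF inj] by (intro sum.cong) (auto simp: e_def insert_commute)
  finally show ?thesis by (simp add: pair_sum_def P_def)
qed

lemma quadratic_indicator:
  assumes "X \<subseteq> {1..n}"
  shows "quadratic n l q (indicator X) = ereal (sum l X) + pair_sum q X"
proof -
  have "(\<Sum>i\<in>{1..n}. ereal (l i) * ereal (indicator X i)) = (\<Sum>i\<in>X. ereal (l i))"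
    using assms by (intro sum.mono_neutral_cong_right) (auto simp: indicator_def)
  \<comment> \<open>Products with a zero coordinate vanish even for infinite
    \<open>q {i, j}\<close>, because \<open>0 * \<infinity> = 0\<close>.\<close>
  moreover have "(\<Sum>i\<in>{1..n}. \<Sum>j\<in>{i<..n}. q {i, j} * ereal (indicator X i) * ereal (indicator X j)) =
      pair_sum q X"
    unfolding pair_sum_def using assms
    by (subst sum.Sigma) (auto simp: indicator_def intro!: sum.mono_neutral_cong_right split: if_splits)
  ultimately show ?thesis by (simp add: quadratic_def)
qed

section \<open>The exchange axiom in terms of subsets\<close>

lemma cube_eq: "cube n = indicator ` Pow {1..n}"
proof (intro equalityI subsetI)
  fix x assume x: "x \<in> cube n"
  then have "x k = indicator {k. x k = 1} k" for k
    by (cases "k \<in> {1..n}") (auto simp: cube_def indicator_def)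
  moreover have "{k. x k = 1} \<subseteq> {1..n}" using x by (force simp: cube_def)
  ultimately show "x \<in> indicator ` Pow {1..n}" by blast
qed (auto simp: cube_def indicator_def)

text \<open>Passing to supports turns the exchange of coordinates into moving elements between sets.
  The index \<open>0\<close>, whose unit vector is zero, becomes the separate first
  alternative.\<close>

lemma M_natural_convex_iff_sets:
  "M_natural_convex n f \<longleftrightarrow>
    (\<forall>X\<subseteq>{1..n}. f (indicator X) \<noteq> -\<infinity>) \<and>
    (\<forall>X\<subseteq>{1..n}. \<forall>Y\<subseteq>{1..n}. \<forall>i\<in>X - Y.
      f (indicator (X - {i})) + f (indicator (insert i Y)) \<le> f (indicator X) + f (indicator Y) \<or>
      (\<exists>j\<in>Y - X. f (indicator (insert j (X - {i}))) + f (indicator (insert i (Y - {j})))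
        \<le> f (indicator X) + f (indicator Y)))"
proof -
  have "(\<forall>i\<in>{1..n}. (indicator X i :: real) > indicator Y i \<longrightarrow>
        (\<exists>j\<in>{j\<in>{1..n}. (indicator Y j :: real) > indicator X j} \<union> {0}.
          f (indicator X) + f (indicator Y) \<ge>
          f (indicator X - unit_vec i + unit_vec j) + f (indicator Y + unit_vec i - unit_vec j))) \<longleftrightarrow>
      (\<forall>i\<in>X - Y.
        f (indicator (X - {i})) + f (indicator (insert i Y)) \<le> f (indicator X) + f (indicator Y) \<or>
        (\<exists>j\<in>Y - X. f (indicator (insert j (X - {i}))) + f (indicator (insert i (Y - {j})))
        \<le> f (indicator X) + f (indicator Y)))"
    if X: "X \<subseteq> {1..n}" and Y: "Y \<subseteq> {1..n}" for X Y
  proof -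
    have gt: "(indicator A k :: real) > indicator B k \<longleftrightarrow> k \<in> A - B" for A B and k :: nat
      by (auto simp: indicator_def)
    have "i \<noteq> 0" if "i \<in> X - Y" for i using that X by force
    then have "indicator X - unit_vec i + unit_vec 0 = (indicator (X - {i}) :: nat \<Rightarrow> real)"
      "indicator Y + unit_vec i - unit_vec 0 = (indicator (insert i Y) :: nat \<Rightarrow> real)"
      if "i \<in> X - Y" for i
      using that by (auto simp: fun_eq_iff unit_vec_def indicator_def)
    moreover have "indicator X - unit_vec i + unit_vec j = (indicator (insert j (X - {i})) :: nat \<Rightarrow> real)"
      "indicator Y + unit_vec i - unit_vec j = (indicator (insert i (Y - {j})) :: nat \<Rightarrow> real)"
      if "i \<in> X - Y" "j \<in> Y - X" for i j
    proof -
      have "i \<noteq> 0" "j \<noteq> 0" using that X Y by force+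
      then show "indicator X - unit_vec i + unit_vec j = (indicator (insert j (X - {i})) :: nat \<Rightarrow> real)"
        "indicator Y + unit_vec i - unit_vec j = (indicator (insert i (Y - {j})) :: nat \<Rightarrow> real)"
        using that by (auto simp: fun_eq_iff unit_vec_def indicator_def)
    qed
    moreover have "{j\<in>{1..n}. j \<in> Y - X} = Y - X" using Y by auto
    moreover have "(\<forall>i\<in>{1..n}. i \<in> X - Y \<longrightarrow> P i) \<longleftrightarrow> (\<forall>i\<in>X - Y. P i)" for P using X by auto
    ultimately show ?thesis unfolding gt by auto
  qed
  then show ?thesis
    unfolding M_natural_convex_def cube_eq by (simp add: ball_simps image_iff Ball_def[of "Pow _"] cong: conj_cong)
qed

text \<open>Inserting \<open>k\<close> into \<open>X\<close> raises the value by
  \<open>sum (d k) X\<close>. Hence both sides of the exchange inequality share all terms that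
  involve \<open>X \<inter> Y\<close>, and what is left is \<open>exchange\<close>.\<close>

lemma M_natural_convex_quadratic_if_ultrametric:
  assumes "ultrametric_similarity d" and q: "\<And>i j. i \<noteq> j \<Longrightarrow> q {i, j} = d i j"
  shows "M_natural_convex n (quadratic n (\<lambda>_. 0) q)"
proof -
  interpret ultrametric_similarity d by fact
  define E where "E = pair_sum q"
  have insert: "E (insert k X) = E X + sum (d k) X" if "finite X" "k \<notin> X" for k X
    unfolding E_def pair_sum_insert[OF that] using that q by (metis (mono_tags, lifting) sum.cong)
  have f: "quadratic n (\<lambda>_. 0) q (indicator X) = E X" if "X \<subseteq> {1..n}" for X
    using that by (simp add: quadratic_indicator E_def)
  have E_nonneg: "0 \<le> E X" for X
    unfolding E_def pair_sum_def using q nonneg by (intro sum_nonneg) (auto split: prod.splits)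
  have E_exchange: "E (X - {i}) + E (insert i Y) \<le> E X + E Y \<or>
      (\<exists>j\<in>Y - X. E (insert j (X - {i})) + E (insert i (Y - {j})) \<le> E X + E Y)"
    if "finite X" "finite Y" "i \<in> X - Y" for X Y i
  proof -
    define A B C where "A = X - Y - {i}" and "B = Y - X" and "C = X \<inter> Y"
    have fin: "finite A" "finite B" "finite C" using that by (auto simp: A_def B_def C_def)
    have XY: "X - {i} = A \<union> C" "Y = B \<union> C" "X = insert i (A \<union> C)"
      and i: "i \<notin> A" "i \<notin> B" "i \<notin> C" and disj: "A \<inter> B = {}" "A \<inter> C = {}" "B \<inter> C = {}"
      using that by (auto simp: A_def B_def C_def)
    have split: "sum g (D \<union> C) = sum g D + sum g C" if "finite D" "D \<inter> C = {}" for g :: "nat \<Rightarrow> ereal" and D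
      using that fin by (simp add: sum.union_disjoint)
    consider "sum (d i) B \<le> sum (d i) A"
      | j where "j \<in> B" "sum (d j) A + sum (d i) (B - {j}) \<le> sum (d i) A + sum (d j) (B - {j})"
      using exchange[OF fin(1,2) i(1,2) disj(1)] by blast
    then show ?thesis
    proof cases
      case 1
      have "E (X - {i}) + E (insert i Y) = E (A \<union> C) + (E (B \<union> C) + (sum (d i) B + sum (d i) C))"
        using fin disj i by (simp add: XY(1,2) insert split)
      also have "\<dots> \<le> E (A \<union> C) + (E (B \<union> C) + (sum (d i) A + sum (d i) C))"
        using 1 by (intro add_left_mono add_right_mono)
      also have "\<dots> = E X + E Y"
        using fin disj i by (simp add: XY(2,3) insert split add_ac)
      finally show ?thesis ..
    next
      case 2
      define D where "D = B - {j}"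
      have j: "j \<notin> A" "j \<notin> C" "j \<notin> D" "j \<noteq> i" and D: "finite D" "D \<inter> C = {}" "i \<notin> D"
        and Y: "Y = insert j (D \<union> C)" "Y - {j} = D \<union> C"
        using 2 fin disj i XY by (auto simp: D_def)
      \<comment> \<open>The last bracket is what \<open>exchange\<close> compares; the rest is
        common to both sides and is added, never cancelled, since it may be infinite.\<close>
      have "E (insert j (X - {i})) + E (insert i (Y - {j})) =
          E (A \<union> C) + E (D \<union> C) + (sum (d j) C + sum (d i) C) + (sum (d j) A + sum (d i) D)"
        using fin disj i j D by (simp add: XY(1) Y(2) insert split add_ac)
      also have "\<dots> \<le> E (A \<union> C) + E (D \<union> C) + (sum (d j) C + sum (d i) C) + (sum (d i) A + sum (d j) D)"
        using 2(2) unfolding D_def by (rule add_left_mono)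
      also have "\<dots> = E X + E Y"
        unfolding Y(1) using fin disj i j D by (simp add: XY(3) insert split add_ac)
      finally show ?thesis using 2(1) unfolding B_def by blast
    qed
  qed
  let ?f = "\<lambda>X. quadratic n (\<lambda>_. 0) q (indicator X)"
  show ?thesis
    unfolding M_natural_convex_iff_sets
  proof (intro conjI allI impI ballI)
    fix X Y i assume X: "X \<subseteq> {1..n}" and Y: "Y \<subseteq> {1..n}" and i: "i \<in> X - Y"
    have fin: "finite X" "finite Y" using X Y finite_subset by auto
    have "?f X = E X" "?f Y = E Y" "?f (X - {i}) = E (X - {i})" "?f (insert i Y) = E (insert i Y)"
      using i X Y by (intro f; blast)+
    moreover have "?f (insert j (X - {i})) + ?f (insert i (Y - {j})) =
      E (insert j (X - {i})) + E (insert i (Y - {j}))" if "j \<in> Y - X" for j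
      using that i X Y by (intro arg_cong2[where f = "(+)"] f; blast)
    ultimately show  "?f (X - {i}) + ?f (insert i Y) \<le> ?f X + ?f Y \<or>
      (\<exists>j\<in>Y - X. ?f (insert j (X - {i})) + ?f (insert i (Y - {j})) \<le> ?f X + ?f Y)"
      using E_exchange[OF fin i] by (metis (no_types, lifting))
  qed (use f E_nonneg in auto)
qed

text \<open>Test the exchange axiom on \<open>{i, j}\<close> and \<open>{k}\<close> at
  \<open>i\<close>: moving \<open>i\<close> alone yields \<open>q {i, k} \<le> q {i, j}\<close>,
  swapping it with \<open>k\<close> yields \<open>q {k, j} \<le> q {i, j}\<close>.\<close>

lemma ultrametric_if_M_natural_convex_quadratic:
  assumes "M_natural_convex n (quadratic n l q)"
    and "i \<in> {1..n}" "j \<in> {1..n}" "k \<in> {1..n}" "i \<noteq> j" "j \<noteq> k" "i \<noteq> k"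
  shows "min (q {i, k}) (q {k, j}) \<le> q {i, j}"
proof -
  have single: "pair_sum q {a} = 0" for a using pair_sum_insert[of "{}" a q] by simp
  have pair: "pair_sum q {a, b} = q {a, b}" if "a \<noteq> b" for a b
    using pair_sum_insert[of "{b}" a q] that single by simp
  have f: "quadratic n l q (indicator X) = ereal (sum l X) + pair_sum q X" if "X \<subseteq> {1..n}" for X
    using that by (rule quadratic_indicator)
  have "{i, j} - {i} = {j}" "insert i {k} = {i, k}" "insert k ({i, j} - {i}) = {k, j}"
      "insert i ({k} - {k}) = {i}" using assms by auto
  moreover have "i \<in> {i, j} - {k}" "{k} - {i, j} = {k}" "{i, j} \<subseteq> {1..n}" "{k} \<subseteq> {1..n}" using assms by auto
  ultimately have "quadratic n l q (indicator {j}) + quadratic n l q (indicator {i, k})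
      \<le> quadratic n l q (indicator {i, j}) + quadratic n l q (indicator {k}) \<or>
    quadratic n l q (indicator {k, j}) + quadratic n l q (indicator {i})
      \<le> quadratic n l q (indicator {i, j}) + quadratic n l q (indicator {k})"
    using assms(1)[unfolded M_natural_convex_iff_sets, THEN conjunct2, rule_format, of "{i, j}" "{k}" i]
    by simp
  then have "ereal (l j) + (ereal (l i + l k) + q {i, k}) \<le> ereal (l i + l j) + q {i, j} + ereal (l k) \<or>
    ereal (l k + l j) + q {k, j} + ereal (l i) \<le> ereal (l i + l j) + q {i, j} + ereal (l k)"
    using assms by (simp add: f single pair del: plus_ereal.simps)
  \<comment> \<open>The linear terms are finite and have the same total on both sides, so they
    cancel even beside infinite values of \<open>q\<close>.\<close>
  then have "q {i, k} \<le> q {i, j} \<or> q {k, j} \<le> q {i, j}"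
    by (cases "q {i, j}"; cases "q {i, k}"; cases "q {k, j}") auto
  then show ?thesis by (simp add: min_le_iff_disj)
qed

section \<open>Cycles and bottleneck paths\<close>

text \<open>Equal edges at different positions would make each position the successor of the other,
  which forces length 2.\<close>

lemma cycle_edges_index_inj:
  assumes "distinct c" "length c \<ge> 3" "k < length c" "m < length c"
    and "{c ! k, c ! (Suc k mod length c)} = {c ! m, c ! (Suc m mod length c)}"
  shows "k = m"
proof (rule ccontr)
  assume "k \<noteq> m"
  have "0 < length c" using assms(2) by linarith
  then have lt: "Suc k mod length c < length c" "Suc m mod length c < length c" by simp_all
  have "k = Suc m mod length c \<and> Suc k mod length c = m"
    using assms(1,3-5) lt \<open>k \<noteq> m\<close> by (auto simp: doubleton_eq_iff nth_eq_iff_index_eq)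
  then show False
    using assms(2-4) by (auto simp: mod_Suc split: if_splits)
qed

text \<open>If one edge alone attained the minimum, the rest of the cycle would join its ends by
  heavier edges, and the ultrametric inequality along that path would push the weight of the edge
  itself above the minimum.\<close>

lemma min_attained_twice_if_ultrametric:
  assumes c: "is_cycle V E c"
    and ultra: "\<And>x y z. x \<in> V \<Longrightarrow> y \<in> V \<Longrightarrow> z \<in> V \<Longrightarrow> x \<noteq> y \<Longrightarrow> y \<noteq> z \<Longrightarrow> x \<noteq> z \<Longrightarrow>
      min (w {x, y}) (w {y, z}) \<le> w {x, z}"
  shows "min_attained_twice w c"
proof -
  define L where "L = length c"
  define e where "e k = {c ! k, c ! (Suc k mod L)}" for k
  have L: "L \<ge> 3" and dist: "distinct c" and V: "set c \<subseteq> V" using c by (auto simp: is_cycle_def L_def)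
  have edges: "cycle_edges c = e ` {..<L}" by (auto simp: cycle_edges_def e_def L_def)
  define M where "M = Min (w ` cycle_edges c)"
  have "M \<in> w ` cycle_edges c" unfolding M_def using L by (intro Min_in) (auto simp: edges lessThan_empty_iff)
  then obtain k where k: "k < L" "w (e k) = M" by (auto simp: edges)
  have M_le: "M \<le> w (e m)" if "m < L" for m unfolding M_def using that by (auto simp: edges)
  \<comment> \<open>\<open>v\<close> walks around the cycle from the end of edge \<open>k\<close> to
    its start \<open>v (L - 1)\<close>, so its steps are all the other edges.\<close>
  define v where "v r = c ! ((Suc k + r) mod L)" for r
  have vV: "v r \<in> V" for r unfolding v_def using L by (intro subsetD[OF V] nth_mem) (simp flip: L_def)
  have v_eq: "v r = v s \<longleftrightarrow> r = s" if "r < L" "s < L" for r s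
  proof -
    have "v r = v s \<longleftrightarrow> (Suc k + r) mod L = (Suc k + s) mod L"
      unfolding v_def by (rule nth_eq_iff_index_eq[OF dist]) (use L in \<open>simp_all flip: L_def\<close>)
    also have "\<dots> \<longleftrightarrow> r = s"
    proof
      assume "(Suc k + r) mod L = (Suc k + s) mod L"
      then obtain a b where "Suc k + r + L * a = Suc k + s + L * b"
        using nat_mod_eq_iff by blast
      then have "(r + L * a) mod L = (s + L * b) mod L" by simp
      then show "r = s" using that by simp
    qed simp
    finally show ?thesis .
  qed
  have last: "v (L - 1) = c ! k" "v 0 = c ! (Suc k mod L)"
    using k L by (auto simp: v_def)
  have "\<exists>m<L. m \<noteq> k \<and> w (e m) = M"
  proof (rule ccontr)
    assume "\<not> ?thesis"
    then have gt: "M < w (e m)" if "m < L" "m \<noteq> k" for m using M_le that by (metis order_le_less)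
    have step: "M < w {v r, v (Suc r)}" if "Suc r < L" for r
    proof -
      have "{v r, v (Suc r)} = e ((Suc k + r) mod L)"
        by (simp add: v_def e_def mod_Suc_eq)
      moreover have "(Suc k + r) mod L \<noteq> k"
      proof
        assume "(Suc k + r) mod L = k"
        then have "v r = v (L - 1)" unfolding last(1) by (simp only: v_def)
        then show False using v_eq[of r "L - 1"] that by simp
      qed
      ultimately show ?thesis using gt L by simp
    qed
    \<comment> \<open>Indexing by \<open>Suc r\<close> keeps the three vertices passed to
      \<open>ultra\<close> distinct.\<close>
    have "M < w {v 0, v (Suc r)}" if "Suc r < L" for r
      using that
    proof (induction r)
      case 0
      then show ?case by (rule step)
    next
      case (Suc r)
      then have "M < min (w {v 0, v (Suc r)}) (w {v (Suc r), v (Suc (Suc r))})"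
        using step[of "Suc r"] by simp
      also have "\<dots> \<le> w {v 0, v (Suc (Suc r))}"
        using Suc.prems vV by (intro ultra) (simp_all add: v_eq)
      finally show ?case .
    qed
    from this[of "L - 2"] have "M < w {v 0, v (L - 1)}"
      using L by (simp add: Suc_diff_Suc numeral_2_eq_2)
    also have "{v 0, v (L - 1)} = e k" by (simp only: last e_def insert_commute)
    finally have "M < w (e k)" .
    then show False using k by simp
  qed
  then obtain m where m: "m < L" "m \<noteq> k" "w (e m) = M" by blast
  have "e k \<noteq> e m" using cycle_edges_index_inj[OF dist] L k m by (auto simp: e_def L_def)
  then show ?thesis unfolding min_attained_twice_def using k m M_def by (metis edges imageI lessThan_iff)
qed

text \<open>A shortest path of heavy edges between the ends of a light edge closes up to a chordless cycle,
  since a heavy chord would shorten the path and a light chord would span a shorter one.\<close>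

lemma weight_ge_if_heavy_path:
  assumes dom: "dom H \<subseteq> pairs n"
    and cyc: "\<And>c. chordless_cycle {1..n} (graph_edges n H) c \<Longrightarrow> min_attained_twice (weight H) c"
    and R: "R = {(x, y). \<exists>b. H {x, y} = Some b \<and> t \<le> b}"
    and uv: "(u, v) \<in> R\<^sup>*" "H {u, v} = Some a"
  shows "t \<le> a"
proof (rule ccontr)
  assume "\<not> t \<le> a"
  define light where "light x y \<longleftrightarrow> (\<exists>b. H {x, y} = Some b \<and> b < t)" for x y
  \<comment> \<open>The minimum ranges over all light pairs, not only \<open>{u, v}\<close>, because
    a light chord produces a new pair.\<close>
  define P where "P m \<longleftrightarrow> (\<exists>x y. light x y \<and> (x, y) \<in> R ^^ m)" for m
  have "\<exists>m. P m" using uv \<open>\<not> t \<le> a\<close> rtrancl_imp_relpow unfolding P_def light_def by (metis not_le)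
  then obtain m where m: "P m" "\<And>m'. P m' \<Longrightarrow> m \<le> m'" by (metis LeastI Least_le)
  obtain x y where xy: "light x y" "(x, y) \<in> R ^^ m" using m(1) P_def by blast
  then obtain f where f: "f 0 = x" "f m = y" "\<And>i. i < m \<Longrightarrow> (f i, f (Suc i)) \<in> R"
    by (auto simp: relpow_fun_conv)
  have pairE: "x \<noteq> y \<and> x \<in> {1..n} \<and> y \<in> {1..n} \<and> {x, y} \<in> graph_edges n H"
    if H: "H {x, y} = Some b" for x y b
  proof -
    have "{x, y} \<in> pairs n" using dom H by blast
    then show ?thesis using H by (auto simp: pairs_def graph_edges_def doubleton_eq_iff)
  qed
  have seg: "(f i, f j) \<in> R ^^ (j - i)" if "i \<le> j" "j \<le> m" for i j
    unfolding relpow_fun_conv using that f(3) by (intro exI[of _ "\<lambda>k. f (i + k)"]) auto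
  have notP: "\<not> P m'" if "m' < m" for m' using m(2) that by fastforce
  have "m \<noteq> 0" using xy pairE f unfolding light_def by fastforce
  moreover have "m \<noteq> 1" using xy f(3)[of 0] f(1,2) unfolding light_def R by auto
  ultimately have m2: "m \<ge> 2" by simp
  \<comment> \<open>Cutting out the loop between two visits of a vertex would shorten the
    path.\<close>
  have distinct: "f i \<noteq> f j" if "i < j" "j \<le> m" for i j
  proof
    assume "f i = f j"
    then have "(f 0, f m) \<in> R ^^ (i - 0) O R ^^ (m - j)"
      using seg[of 0 i] seg[of j m] that by auto
    then have "(x, y) \<in> R ^^ (i + (m - j))" using f by (simp add: relpow_add)
    then show False using notP[of "i + (m - j)"] xy that unfolding P_def by auto
  qed
  have chord: "H {f i, f j} = None" if ij: "Suc i < j" "j \<le> m" "\<not> (i = 0 \<and> j = m)" for i j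
  proof (rule ccontr)
    assume "H {f i, f j} \<noteq> None"
    then obtain b where b: "H {f i, f j} = Some b" by blast
    show False
    proof (cases "b < t")
      case True
      then have "P (j - i)" unfolding P_def light_def using seg[of i j] b ij by auto
      then show False using notP[of "j - i"] ij by (cases "i = 0") auto
    next
      case False
      then have "(f i, f j) \<in> R ^^ 1" using b R by auto
      moreover have "(f 0, f i) \<in> R ^^ i" "(f j, f m) \<in> R ^^ (m - j)"
        using seg[of 0 i] seg[of j m] ij by auto
      ultimately have "(x, y) \<in> R ^^ (i + (1 + (m - j)))"
        using f(1,2) unfolding relpow_add by blast
      then show False using notP[of "i + (1 + (m - j))"] xy ij unfolding P_def by auto
    qed
  qed
  define c where "c = map f [0..<Suc m]"
  have len: "length c = Suc m" and nth: "\<And>k. k \<le> m \<Longrightarrow> c ! k = f k"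
    by (auto simp: c_def simp del: upt_Suc)
  \<comment> \<open>Position \<open>m\<close> closes the cycle: its edge is the light pair
    \<open>{x, y}\<close>, all others are heavy.\<close>
  have next_edge: "{c ! k, c ! (Suc k mod length c)} = (if k = m then {x, y} else {f k, f (Suc k)})"
    if "k < length c" for k
    using that f by (auto simp: len nth)
  have heavy: "H {f k, f (Suc k)} \<noteq> None \<and> t \<le> weight H {f k, f (Suc k)}" if "k < m" for k
    using f(3)[OF that] unfolding R by (auto simp: weight_def)
  have "distinct c"
    unfolding c_def distinct_map by (auto simp: inj_on_def simp del: upt_Suc) (metis distinct less_Suc_eq_le linorder_neqE_nat)
  moreover have "set c \<subseteq> {1..n}"
  proof
    fix z assume "z \<in> set c"
    then obtain k where k: "k \<le> m" "z = f k" by (auto simp: c_def less_Suc_eq_le simp del: upt_Suc)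
    show "z \<in> {1..n}"
    proof (cases "k = m")
      case True
      then show ?thesis using xy pairE f k unfolding light_def by blast
    next
      case False
      then show ?thesis using heavy[of k] pairE k by (metis le_neq_implies_less not_None_eq)
    qed
  qed
  moreover have "cycle_edges c \<subseteq> graph_edges n H"
  proof
    fix e assume "e \<in> cycle_edges c"
    then obtain k where "k < length c" "e = (if k = m then {x, y} else {f k, f (Suc k)})"
      unfolding cycle_edges_def using next_edge by blast
    then show "e \<in> graph_edges n H"
      using xy heavy[of k] pairE unfolding light_def len by (auto split: if_splits)
  qed
  moreover have "{c ! i, c ! j} \<notin> graph_edges n H"
    if "i < length c" "j < length c" "i \<noteq> j" "j \<noteq> Suc i mod length c" "i \<noteq> Suc j mod length c" for i j
  proof -
    have *: "H {f i, f j} = None" if "i < j" "j \<le> m" "j \<noteq> Suc i mod Suc m" "i \<noteq> Suc j mod Suc m" for i j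
      using that by (intro chord) (auto simp: mod_Suc split: if_splits)
    have "H {f i, f j} = None"
      using *[of i j] *[of j i] that by (cases "i < j") (auto simp: len insert_commute)
    then show ?thesis using that by (simp add: nth len graph_edges_def)
  qed
  ultimately have "chordless_cycle {1..n} (graph_edges n H) c"
    using m2 unfolding chordless_cycle_def is_cycle_def len by auto
  then obtain e e' where ee: "e \<in> cycle_edges c" "e' \<in> cycle_edges c" "e \<noteq> e'"
    "weight H e = Min (weight H ` cycle_edges c)" "weight H e' = Min (weight H ` cycle_edges c)"
    using cyc unfolding min_attained_twice_def by blast
  have fin: "finite (cycle_edges c)" unfolding cycle_edges_def by simp
  have "{x, y} \<in> cycle_edges c" unfolding cycle_edges_def using next_edge[of m] len by force
  then have "Min (weight H ` cycle_edges c) \<le> weight H {x, y}" using fin by simp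
  also have "\<dots> < t" using xy unfolding light_def weight_def by auto
  finally have lt: "Min (weight H ` cycle_edges c) < t" .
  \<comment> \<open>Only \<open>{x, y}\<close> is lighter than \<open>t\<close>, so the minimum
    cannot be attained at two edges.\<close>
  have "e'' = {x, y}" if e'': "e'' \<in> cycle_edges c" "weight H e'' < t" for e''
  proof -
    obtain k where k: "k < length c" "e'' = (if k = m then {x, y} else {f k, f (Suc k)})"
      using e''(1) unfolding cycle_edges_def using next_edge by blast
    then show ?thesis using e''(2) heavy[of k] len by (auto split: if_splits)
  qed
  then show False using ee lt by metis
qed

text \<open>With \<open>R t\<close> read as the edges of weight at least \<open>t\<close>, the
  supremum is the bottleneck value of the best path, and paths can be concatenated at a common
  level. The inserted \<open>0\<close> is the default without a path; reflexivity gives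
  \<open>\<infinity>\<close> on the diagonal.\<close>

lemma ultrametric_similarity_bottleneck:
  assumes sym: "\<And>t. sym (R t)" and mono: "\<And>s t. s \<le> t \<Longrightarrow> R t \<subseteq> R s"
  shows "ultrametric_similarity (\<lambda>x y. Sup (insert (0 :: ereal) {t. (x, y) \<in> (R t)\<^sup>*}))"
    (is "ultrametric_similarity ?d")
proof
  fix x y z
  show "?d x x = \<infinity>" by (simp flip: top_ereal_def)
  show "?d x y = ?d y x" using sym_rtrancl[OF sym] by (metis symD)
  show "0 \<le> ?d x y" by simp
  show "min (?d x y) (?d y z) \<le> ?d x z"
  \<comment> \<open>The suprema need not be attained, so only levels strictly below them are
    used.\<close>
  proof (rule dense_le)
    fix t assume t: "t < min (?d x y) (?d y z)"
    show "t \<le> ?d x z"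
    proof (cases "t < 0")
      case True
      then show ?thesis by (intro order_trans[OF order_less_imp_le Sup_upper]) auto
    next
      case False
      \<comment> \<open>As \<open>t\<close> is not negative, the inserted \<open>0\<close> cannot
        witness \<open>t < ?d a b\<close>; a connecting level above \<open>t\<close> does, and
        monotonicity lowers it to \<open>t\<close>.\<close>
      have step: "(a, b) \<in> (R t)\<^sup>*" if "t < ?d a b" for a b
        using that False mono unfolding less_Sup_iff
        by (metis insert_iff mem_Collect_eq order_less_imp_le rtrancl_mono subsetD)
      have "(x, z) \<in> (R t)\<^sup>*" using step[of x y] step[of y z] t by (auto intro: rtrancl_trans)
      then show ?thesis by (intro Sup_upper) simp
    qed
  qed
qed

section \<open>Completability and chordless cycles\<close>

theorem theorem2:
  fixes n :: nat and H :: "nat set \<rightharpoonup> ereal"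
  assumes "n \<ge> 2"
    and "partial_matrix n H"
    and "\<And>e a. H e = Some a \<Longrightarrow> a \<ge> 0"
    and "\<And>i j k a b c. i \<noteq> j \<Longrightarrow> j \<noteq> k \<Longrightarrow> i \<noteq> k \<Longrightarrow>
           H {i, j} = Some a \<Longrightarrow> H {j, k} = Some b \<Longrightarrow> H {i, k} = Some c \<Longrightarrow> a \<ge> min b c"
  shows "M_natural_convex_completable n H \<longleftrightarrow>
    (\<forall>c. chordless_cycle {1..n} (graph_edges n H) c \<longrightarrow> min_attained_twice (weight H) c)"
proof
  assume "M_natural_convex_completable n H"
  then obtain q l where ext: "\<And>e a. e \<in> pairs n \<Longrightarrow> H e = Some a \<Longrightarrow> q e = a"
    and conv: "M_natural_convex n (quadratic n l q)"
    unfolding M_natural_convex_completable_def by blast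
  show "\<forall>c. chordless_cycle {1..n} (graph_edges n H) c \<longrightarrow> min_attained_twice (weight H) c"
  proof (intro allI impI)
    fix c assume "chordless_cycle {1..n} (graph_edges n H) c"
    then have c: "is_cycle {1..n} (graph_edges n H) c" by (simp add: chordless_cycle_def)
    \<comment> \<open>Cycle edges carry defined entries, where the completion \<open>q\<close>
      agrees with \<open>H\<close>.\<close>
    have "weight H e = q e" if "e \<in> cycle_edges c" for e
      using c that ext by (force simp: is_cycle_def graph_edges_def weight_def)
    then have "weight H ` cycle_edges c = q ` cycle_edges c"
      "\<And>e. e \<in> cycle_edges c \<Longrightarrow> weight H e = q e" by auto
    moreover have "min_attained_twice q c"
      using c by (rule min_attained_twice_if_ultrametric)
        (use ultrametric_if_M_natural_convex_quadratic[OF conv] in auto)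
    ultimately show "min_attained_twice (weight H) c" unfolding min_attained_twice_def by metis
  qed
next
  assume cyc: "\<forall>c. chordless_cycle {1..n} (graph_edges n H) c \<longrightarrow> min_attained_twice (weight H) c"
  have dom: "dom H \<subseteq> pairs n" using assms(2) by (simp add: partial_matrix_def)
  define R where "R t = {(x, y). \<exists>b. H {x, y} = Some b \<and> t \<le> b}" for t
  define d where "d x y = Sup (insert 0 {t. (x, y) \<in> (R t)\<^sup>*})" for x y
  have d: "ultrametric_similarity d"
    unfolding d_def by (rule ultrametric_similarity_bottleneck)
      (auto simp: R_def sym_def insert_commute)
  then interpret ultrametric_similarity d .
  \<comment> \<open>\<open>Min\<close> and \<open>Max\<close> recover the two ends of an unordered
    pair; by symmetry of \<open>d\<close> their order does not matter.\<close>
  define q where "q e = d (Min e) (Max e)" for e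
  have q: "q {x, y} = d x y" for x y
    using sym by (auto simp: q_def min_def max_def)
  have "q e = a" if e: "e \<in> pairs n" "H e = Some a" for e a
  proof -
    obtain x y where xy: "e = {x, y}" using e(1) by (auto simp: pairs_def)
    \<comment> \<open>The edge itself is a path of bottleneck \<open>a\<close>, and by
      \<open>weight_ge_if_heavy_path\<close> no path between its ends does better.\<close>
    have "d x y = a" unfolding d_def
    proof (rule Sup_eqI)
      fix t assume "t \<in> insert 0 {t. (x, y) \<in> (R t)\<^sup>*}"
      then consider "t = 0" | "(x, y) \<in> (R t)\<^sup>*" by blast
      then show "t \<le> a"
      proof cases
        case 1
        then show ?thesis using assms(3)[OF e(2)] by simp
      next
        case 2
        show ?thesis
          by (rule weight_ge_if_heavy_path[OF dom _ R_def 2 e(2)[unfolded xy]]) (use cyc in blast)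
      qed
    next
      fix z assume "\<And>t. t \<in> insert 0 {t. (x, y) \<in> (R t)\<^sup>*} \<Longrightarrow> t \<le> z"
      moreover have "(x, y) \<in> R a" using e(2) xy by (simp add: R_def)
      ultimately show "a \<le> z" by blast
    qed
    then show ?thesis by (simp add: q xy)
  qed
  moreover have "q e \<noteq> -\<infinity>" for e
    using nonneg[of "Min e" "Max e"] by (auto simp: q_def)
  moreover have "M_natural_convex n (quadratic n (\<lambda>_. 0) q)"
    using d q by (rule M_natural_convex_quadratic_if_ultrametric)
  ultimately show "M_natural_convex_completable n H"
    unfolding M_natural_convex_completable_def by (intro exI[of _ q] exI[of _ "\<lambda>_. 0"]) simp
qed

end
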